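(* Let $\lambda < 0$ be real, and let $K\subset\mathbb{C}$ be compact. Put $$u = \frac{\log|\lambda|+\pi i}{\log|\lambda|-\pi i}.$$ Then as $n \to \infty$, for $z\in K$, $$\frac{(-1)^{n-1}(\log\lambda)^{n}}{n!} \lambda^{z} \mathcal{B}_{n}(z;\lambda) = 1 + u^{n} e^{2\pi i z} + O\left( \frac{e^{2(\pi + |\log\lambda|)|z|}}{\left|1 + \frac{2\pi i}{\log\lambda}\right|^{n}} \right),$$ where the constant implicit in the order term depends only on $\lambda$ and $K$. Moreover, for $n$ sufficiently large (depending on $K$) it may be taken equal to the corresponding constant for $z=0$, thus making it independent of $K$ (i.e. if $c$ is a constant for which the estimate holds at $z=0$ for all $n\ge 2$, then it holds with the constant $c$ for all $z\in K$ and all $n\ge N$, for some $N$ depending on $K$). The number $u$ has modulus $1$, hence the sequence $(u^n)_{n}$ is periodic or dense in the unit circle according as the argument of $u$ is a rational or irrational multiple of $2\pi$. In particular, $$\lim_{n \to \infty} \left( \frac{(-1)^{n-1}(\log\lambda)^{n}}{n!} \lambda^{z} \mathcal{B}_{n}(z;\lambda) - \left(\frac{\log|\lambda|+\pi i}{\log|\lambda|-\pi i}\right)^{n} e^{2\pi i z} \right) = 1$$ uniformly for $z$ in compact subsets of $\mathbb{C}$.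
   Context: The Apostol-Bernoulli polynomials $\mathcal{B}_n(x;\lambda)$ ($n\ge 0$, $\lambda\in\mathbb{C}$) are defined by the power series expansion at $z=0$ $$\frac{z e^{xz}}{\lambda e^z-1} = \sum_{n=0}^\infty \mathcal{B}_n(x;\lambda)\, \frac{z^n}{n!}.$$ $\log$ denotes the principal branch, $\log\lambda = \log|\lambda| + i\arg\lambda$ with $-\pi<\arg\lambda\le\pi$ (so $\log\lambda=\log|\lambda|+\pi i$ for $\lambda<0$), and $\lambda^z = e^{z\log\lambda}$. *)

theory Defs
  imports "HOL-Complex_Analysis.Complex_Analysis"
begin

text \<open>
  Division is that of formal power series, which cancels a common power of the indeterminate;
  hence the definition is also the intended one for \<open>lam = 1\<close> (the classical Bernoulli
  polynomials), where the generating function has a removable singularity at 0.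
\<close>

definition apostol_bernoulli_gf :: "complex \<Rightarrow> complex \<Rightarrow> complex fps" where
  "apostol_bernoulli_gf x lam = (fps_X * fps_exp x) / (fps_const lam * fps_exp 1 - 1)"

definition apostol_bernoulli :: "nat \<Rightarrow> complex \<Rightarrow> complex \<Rightarrow> complex" where
  "apostol_bernoulli n x lam = fact n * fps_nth (apostol_bernoulli_gf x lam) n"

lemma has_fps_expansion_apostol_bernoulli_gf:
  assumes "lam \<noteq> 1"
  shows "(\<lambda>z. z * exp (x * z) / (lam * exp z - 1)) has_fps_expansion apostol_bernoulli_gf x lam"
proof -
  have "(\<lambda>z::complex. exp (1 * z)) has_fps_expansion fps_exp 1"
    by (rule has_fps_expansion_exp)
  hence "(\<lambda>z::complex. lam * exp z - 1) has_fps_expansion (fps_const lam * fps_exp 1 - 1)"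
    by (auto intro!: fps_expansion_intros)
  moreover have "(\<lambda>z. z * exp (x * z)) has_fps_expansion (fps_X * fps_exp x)"
    by (intro fps_expansion_intros)
  ultimately show ?thesis
    unfolding apostol_bernoulli_gf_def using assms
    by (intro has_fps_expansion_divide') auto
qed

end

theory Submission
  imports Defs
begin

text \<open>
  Write \<open>L = log \<lambda> = log \<bar>\<lambda>\<bar> + \<pi> i\<close>. The generating function \<open>w exp (z w) / (\<lambda> exp w - 1)\<close> has simple
  poles exactly at the points \<open>p\<^sub>k = 2 \<pi> i k - L\<close>, and its coefficients are governed by the
  residues there: up to exponentially smaller terms, the \<open>n\<close>-th coefficient is minus the sum of
  \<open>exp (z p\<^sub>k) / p\<^sub>k ^ n\<close> over the poles nearest to the origin. After multiplication by
  \<open>(-1) ^ (n - 1) L ^ n \<lambda> ^ z\<close> the pole \<open>p\<^sub>k\<close> contributes \<open>(L / (L - 2 \<pi> i k)) ^ n exp (2 \<pi> i k z)\<close>.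
  Since \<open>\<bar>p\<^sub>k\<bar>\<^sup>2 = (log \<bar>\<lambda>\<bar>)\<^sup>2 + (2 k - 1)\<^sup>2 \<pi>\<^sup>2\<close>, the poles come in pairs of equal modulus. The pair
  \<open>k = 0, 1\<close> gives the main terms \<open>1\<close> and \<open>u ^ n exp (2 \<pi> i z)\<close>; the pair \<open>k = -1, 2\<close> has modulus
  \<open>d = \<bar>L + 2 \<pi> i\<bar>\<close> and gives an error of order \<open>q ^ n\<close>, where \<open>q = \<bar>L\<bar> / d\<close>. Integrating over
  the circle of radius \<open>r = \<bar>L + 3 \<pi> i\<bar>\<close>, which separates the second pair from the third, bounds
  everything else by \<open>O ((\<bar>L\<bar> / r) ^ n)\<close> (\<open>coefficient_plus_residues_bound\<close>,
  \<open>four_pole_remainder_bounds\<close>).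

  That a constant \<open>c\<close> valid at \<open>z = 0\<close> remains valid on all of \<open>K\<close> for large \<open>n\<close> needs more than
  this, because \<open>c\<close> may be the best possible one and the factor \<open>exp (2 (\<pi> + \<bar>L\<bar>) \<bar>z\<bar>)\<close> leaves no
  room near \<open>z = 0\<close>. Two facts suffice. At \<open>z = 0\<close> the second pair contributes
  \<open>q ^ n \<bar>1 + v ^ n\<bar>\<close> with \<open>\<bar>v\<bar> = 1\<close>, and \<open>v ^ n\<close> returns arbitrarily close to \<open>1\<close>, so necessarily
  \<open>c \<ge> 2\<close> (\<open>two_le_bound_of_unimodular_sum\<close>). Moreover the remainder after four poles is not only
  small but Lipschitz in \<open>z \<in> K\<close> with an exponentially small relative constant, so that the total change
  of the error between \<open>0\<close> and \<open>z\<close> is at most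
  \<open>q ^ n ((exp (2 \<pi> \<bar>z\<bar>) - 1) + (exp (4 \<pi> \<bar>z\<bar>) - 1) + 2 \<pi> \<bar>z\<bar>)\<close> for large \<open>n\<close>. For \<open>c \<ge> 2\<close> and
  \<open>2 (\<pi> + \<bar>L\<bar>) \<ge> 4 \<pi>\<close> the growth of the exponential weight covers this change
  (\<open>sharp_constant_absorption\<close>).

  The two assertions on the orbit of \<open>u\<close> concern any number of modulus \<open>1\<close>; density for irrational
  angle is Kronecker's theorem transported to the circle.
\<close>

section \<open>Estimates for the exponential function\<close>

lemma norm_exp_minus_one_le:
  fixes w :: complex
  shows "norm (exp w - 1) \<le> exp (norm w) - 1"
proof -
  have s: "(\<lambda>n. w ^ Suc n /\<^sub>R fact (Suc n)) sums (exp w - 1)"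
    using exp_converges[of w] by (subst sums_Suc_iff) simp
  have t: "(\<lambda>n. norm w ^ Suc n /\<^sub>R fact (Suc n)) sums (exp (norm w) - 1)"
    using exp_converges[of "norm w"] by (subst sums_Suc_iff) simp
  have "norm (\<Sum>n. w ^ Suc n /\<^sub>R fact (Suc n)) \<le> (\<Sum>n. norm w ^ Suc n /\<^sub>R fact (Suc n))"
    by (rule norm_suminf_le)
       (use t in \<open>auto simp: norm_mult norm_power sums_iff simp del: fact_Suc\<close>)
  thus ?thesis using s t by (simp add: sums_iff)
qed

lemma norm_exp_minus_one_le_linear:
  fixes w :: complex
  shows "norm (exp w - 1) \<le> norm w * exp (norm w)"
proof -
  have "1 - norm w \<le> exp (- norm w)"
    using exp_ge_add_one_self[of "- norm w"] by simp
  hence "(1 - norm w) * exp (norm w) \<le> exp (- norm w) * exp (norm w)"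
    by (intro mult_right_mono) auto
  hence "(1 - norm w) * exp (norm w) \<le> 1" by (simp flip: exp_add)
  with norm_exp_minus_one_le[of w] show ?thesis by (simp add: algebra_simps)
qed

section \<open>Powers of a number of modulus one\<close>

text \<open>
  By compactness the powers of \<open>v\<close> have a convergent, hence Cauchy, subsequence; the quotient of two
  late members of it is again a power of \<open>v\<close> and is close to \<open>1\<close>. This covers rational and
  irrational angles at once.
\<close>

lemma unimodular_power_recurs:
  fixes v :: complex
  assumes "norm v = 1" "\<epsilon> > 0"
  shows "\<exists>n\<ge>N. norm (v ^ n - 1) < \<epsilon>"
proof -
  have "\<forall>n. v ^ n \<in> sphere 0 1" using assms by (simp add: norm_power)
  then obtain l r where r: "strict_mono (r :: nat \<Rightarrow> nat)" "((\<lambda>n. v ^ n) \<circ> r) \<longlonglongrightarrow> l"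
    using compact_sphere[of "0::complex" 1] unfolding compact_def by metis
  from LIMSEQ_imp_Cauchy[OF r(2)] \<open>\<epsilon> > 0\<close> obtain M
    where M: "\<And>m. m \<ge> M \<Longrightarrow> dist (v ^ r m) (v ^ r M) < \<epsilon>"
    by (auto simp: Cauchy_altdef2)
  define m where "m = M + N + r M"
  have "m \<le> r m" using r(1) by (rule seq_suble)
  hence le: "r M + N \<le> r m" by (simp add: m_def)
  have "v ^ r m - v ^ r M = v ^ r M * (v ^ (r m - r M) - 1)"
    using le by (simp add: algebra_simps flip: power_add)
  hence "norm (v ^ (r m - r M) - 1) = dist (v ^ r m) (v ^ r M)"
    using assms(1) by (simp add: dist_norm norm_mult norm_power)
  with M[of m] le show ?thesis by (intro exI[of _ "r m - r M"]) (simp add: m_def)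
qed

lemma unimodular_power_periodic:
  fixes u :: complex
  assumes "norm u = 1" "Arg u / (2 * pi) \<in> \<rat>"
  shows "\<exists>p>0. \<forall>n. u ^ (n + p) = u ^ n"
proof -
  obtain a b :: int where ab: "b > 0" "Arg u / (2 * pi) = of_int a / of_int b"
    using assms(2) by (elim Rats_cases') auto
  have u: "u = cis (Arg u)"
    using assms(1) cis_Arg[of u] by (force simp: sgn_div_norm)
  have "real (nat b) * Arg u = 2 * pi * of_int a"
    using ab by (simp add: field_simps)
  moreover have "u ^ nat b = cis (real (nat b) * Arg u)"
    by (subst u) (rule Complex.DeMoivre)
  ultimately have "u ^ nat b = cis (2 * pi * of_int a)" by simp
  hence "u ^ nat b = 1" by (simp add: cis_multiple_2pi)
  thus ?thesis using ab by (intro exI[of _ "nat b"]) (simp add: power_add)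
qed

lemma unimodular_power_dense:
  fixes u :: complex
  assumes "norm u = 1" "Arg u / (2 * pi) \<notin> \<rat>"
  shows "closure (range (\<lambda>n. u ^ n)) = sphere 0 1"
proof
  show "closure (range (\<lambda>n. u ^ n)) \<subseteq> sphere 0 1"
    by (rule closure_minimal) (use assms in \<open>auto simp: norm_power\<close>)
  define \<theta> where "\<theta> = Arg u / (2 * pi)"
  have u: "u = cis (Arg u)"
    using assms(1) cis_Arg[of u] by (force simp: sgn_div_norm)
  have pow: "cis (2 * pi * frac (real n * \<theta>)) = u ^ n" for n
  proof -
    have "cis (2 * pi * frac (real n * \<theta>)) = cis (real n * Arg u) / cis (2 * pi * of_int \<lfloor>real n * \<theta>\<rfloor>)"
      unfolding cis_divide by (rule arg_cong[of _ _ cis]) (simp add: frac_def \<theta>_def right_diff_distrib)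
    also have "\<dots> = cis (real n * Arg u)" by (simp add: cis_multiple_2pi)
    also have "\<dots> = u ^ n" by (subst (2) u) (rule Complex.DeMoivre[symmetric])
    finally show ?thesis .
  qed
  show "sphere 0 1 \<subseteq> closure (range (\<lambda>n. u ^ n))"
  proof
    fix z :: complex assume "z \<in> sphere 0 1"
    hence z: "z = cis (Arg2pi z)"
      using Arg2pi_eq[of z] by (simp add: cis_conv_exp)
    have "(\<lambda>t. cis (2 * pi * t)) ` closure (range (\<lambda>n. frac (real n * \<theta>)))
          \<subseteq> closure ((\<lambda>t. cis (2 * pi * t)) ` range (\<lambda>n. frac (real n * \<theta>)))"
      by (intro continuous_image_closure_subset[where A = UNIV]) (auto intro!: continuous_intros)
    also have "(\<lambda>t. cis (2 * pi * t)) ` range (\<lambda>n. frac (real n * \<theta>)) = range (\<lambda>n. u ^ n)"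
      by (simp add: image_image pow)
    also have "closure (range (\<lambda>n. frac (real n * \<theta>))) = {0..1}"
      using assms(2) by (intro Kronecker_approx_1) (simp add: \<theta>_def)
    finally have *: "(\<lambda>t. cis (2 * pi * t)) ` {0..1} \<subseteq> closure (range (\<lambda>n. u ^ n))" .
    have "Arg2pi z / (2 * pi) \<in> {0..1}"
      using Arg2pi[of z] by (auto simp: field_simps)
    from imageI[OF this, of "\<lambda>t. cis (2 * pi * t)"] * z
    show "z \<in> closure (range (\<lambda>n. u ^ n))" by auto
  qed
qed

section \<open>Coefficients of functions with the poles of the generating function\<close>

lemma exp_times_exp_eq_1_iff:
  "exp L * exp w = (1 :: complex) \<longleftrightarrow> (\<exists>k::int. w = 2 * of_real pi * \<i> * of_int k - L)"
  unfolding exp_add[symmetric] exp_eq[of _ 0, simplified]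
  by (simp add: algebra_simps)

text \<open>
  The residue theorem for \<open>h w / ((exp L * exp w - 1) * w ^ (n + 1))\<close> on the circle of radius \<open>r\<close>:
  the residue at \<open>0\<close> is the coefficient, and the residue at a zero \<open>p k\<close> of the denominator is
  \<open>h (p k) / p k ^ (n + 1)\<close>, because there the derivative of \<open>exp L * exp w - 1\<close> equals \<open>1\<close>. The
  numerator \<open>h\<close> is arbitrary so that the estimate can be used both for the generating function and
  for the difference of two generating functions with different parameters.
\<close>

lemma coefficient_plus_residues_bound:
  fixes L :: complex and h :: "complex \<Rightarrow> complex" and F :: "complex fps"
  defines "p \<equiv> \<lambda>k::int. 2 * of_real pi * \<i> * of_int k - L"
  assumes L: "exp L \<noteq> 1" and h: "h holomorphic_on UNIV"
    and F: "(\<lambda>w. h w / (exp L * exp w - 1)) has_fps_expansion F"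
    and r: "r > 0" and B: "\<And>w. norm w = r \<Longrightarrow> norm (h w) \<le> B"
    and m: "m > 0" "\<And>w. norm w = r \<Longrightarrow> m \<le> norm (exp L * exp w - 1)"
  shows "norm (fps_nth F n + (\<Sum>k | norm (p k) < r. h (p k) / p k ^ Suc n)) \<le> B / (m * r ^ n)"
proof -
  define f where "f = (\<lambda>w. h w / (exp L * exp w - 1) / w ^ Suc n)"
  \<comment> \<open>The domain for the residue theorem is the slightly larger disc of radius \<open>r + 1\<close>; its poles
      outside the circle have winding number \<open>0\<close>.\<close>
  define Z where "Z = {k. norm (p k) < r + 1}"
  define g where "g = circlepath 0 r"
  have zero: "exp L * exp w - 1 = 0 \<longleftrightarrow> w \<in> range p" for w
    using exp_times_exp_eq_1_iff[of L w] by (auto simp: p_def)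
  have p0: "p k \<noteq> 0" for k
    using zero[of 0] L by (metis exp_zero mult_1_right rangeI right_minus_eq)
  have pr: "norm (p k) \<noteq> r" for k
    using m zero[of "p k"] by force
  have inj: "inj_on p A" for A by (auto simp: inj_on_def p_def)
  have "finite Z"
  proof (rule finite_subset)
    define b where "b = \<lceil>r + 1 + norm L\<rceil>"
    show "Z \<subseteq> {-b..b}"
    proof
      fix k assume "k \<in> Z"
      have "2 * pi * \<bar>of_int k\<bar> = norm (p k + L)" by (simp add: p_def norm_mult)
      also have "\<dots> \<le> norm (p k) + norm L" by (rule norm_triangle_ineq)
      also have "\<dots> \<le> r + 1 + norm L" using \<open>k \<in> Z\<close> by (simp add: Z_def)
      also have "\<dots> \<le> of_int b" by (simp add: b_def)
      finally have "2 * pi * \<bar>of_int k\<bar> \<le> of_int b" .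
      moreover have "1 * \<bar>of_int k\<bar> \<le> 2 * pi * \<bar>real_of_int k\<bar>"
        using pi_gt3 by (intro mult_right_mono) auto
      ultimately have "of_int \<bar>k\<bar> \<le> (of_int b :: real)" by simp
      thus "k \<in> {-b..b}" unfolding of_int_le_iff by auto
    qed
  qed auto
  have pts: "insert 0 (p ` Z) \<inter> sphere 0 r = {}" using pr r by auto
  have holo: "f holomorphic_on ball 0 (r + 1) - insert 0 (p ` Z)"
    unfolding f_def using zero
    by (intro holomorphic_intros holomorphic_on_subset[OF h]) (auto simp: Z_def)
  have res0: "residue f 0 = fps_nth F n"
    unfolding f_def by (rule residue_fps_expansion_over_power_at_0[OF F])
  \<comment> \<open>The limit form of the residue also covers the case that \<open>h\<close> vanishes at \<open>p k\<close>, where the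
      singularity is removable.\<close>
  have res: "residue f (p k) = h (p k) / p k ^ Suc n" if "norm (p k) < r" for k
  proof (rule residue_simple'[of "ball 0 (r + 1) - (insert 0 (p ` Z) - {p k})"])
    show "open (ball 0 (r + 1) - (insert 0 (p ` Z) - {p k}))"
      using \<open>finite Z\<close> by (intro open_Diff finite_imp_closed) auto
    show "p k \<in> ball 0 (r + 1) - (insert 0 (p ` Z) - {p k})" using that by simp
    show "f holomorphic_on ball 0 (r + 1) - (insert 0 (p ` Z) - {p k}) - {p k}"
      by (rule holomorphic_on_subset[OF holo]) auto
    have e: "exp L * exp (p k) = 1" using zero[of "p k"] by simp
    have "((\<lambda>w. exp L * exp w - 1) has_field_derivative 1) (at (p k))"
      using e by (auto intro!: derivative_eq_intros simp: mult.commute)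
    hence deriv: "((\<lambda>w. (exp L * exp w - 1) / (w - p k)) \<longlongrightarrow> 1) (at (p k))"
      using e by (simp add: has_field_derivative_iff)
    have "isCont h (p k)"
      using h holomorphic_on_imp_continuous_on continuous_on_eq_continuous_at by blast
    hence "(\<lambda>w. h w / w ^ Suc n) \<midarrow>p k\<rightarrow> h (p k) / p k ^ Suc n"
      using p0[of k] by (intro tendsto_intros) (auto simp: isCont_def)
    hence "(\<lambda>w. h w / w ^ Suc n / ((exp L * exp w - 1) / (w - p k)))
                       \<midarrow>p k\<rightarrow> h (p k) / p k ^ Suc n / 1"
      using deriv by (rule tendsto_divide) simp
    thus "(\<lambda>w. f w * (w - p k)) \<midarrow>p k\<rightarrow> h (p k) / p k ^ Suc n"
      by (simp add: f_def mult_ac)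
  qed
  have "contour_integral g f =
          2 * pi * \<i> * (\<Sum>q\<in>insert 0 (p ` Z). winding_number g q * residue f q)"
  proof (rule Residue_theorem)
    show "path_image g \<subseteq> ball 0 (r + 1) - insert 0 (p ` Z)"
      using pts r by (auto simp: g_def)
    show "\<forall>z. z \<notin> ball 0 (r + 1) \<longrightarrow> winding_number g z = 0"
      using r by (auto simp: g_def intro!: winding_number_zero_outside[of _ "cball 0 r"])
  qed (use holo \<open>finite Z\<close> in \<open>auto simp: g_def\<close>)
  also have "(\<Sum>q\<in>insert 0 (p ` Z). winding_number g q * residue f q) =
             winding_number g 0 * residue f 0 + (\<Sum>k\<in>Z. winding_number g (p k) * residue f (p k))"
  proof -
    have "0 \<notin> p ` Z" using p0 by (metis imageE)
    thus ?thesis using \<open>finite Z\<close> by (simp add: sum.reindex[OF inj])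
  qed
  also have "(\<Sum>k\<in>Z. winding_number g (p k) * residue f (p k)) =
             (\<Sum>k | norm (p k) < r. h (p k) / p k ^ Suc n)"
  proof (rule sum.mono_neutral_cong_right)
    show "\<forall>k\<in>Z - {k. norm (p k) < r}. winding_number g (p k) * residue f (p k) = 0"
    proof
      fix k assume "k \<in> Z - {k. norm (p k) < r}"
      hence "winding_number g (p k) = 0"
        using r pr[of k] by (auto simp: g_def intro!: winding_number_zero_outside[of _ "cball 0 r"])
      thus "winding_number g (p k) * residue f (p k) = 0" by simp
    qed
  qed (use \<open>finite Z\<close> res in \<open>auto simp: Z_def g_def winding_number_circlepath\<close>)
  also have "winding_number g 0 * residue f 0 = fps_nth F n"
    using r by (simp add: g_def winding_number_circlepath_centre res0)
  finally have I: "contour_integral g f = 2 * pi * \<i> *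
      (fps_nth F n + (\<Sum>k | norm (p k) < r. h (p k) / p k ^ Suc n))" (is "_ = _ * ?S") .
  have "f contour_integrable_on g" unfolding g_def
    by (intro contour_integrable_continuous_circlepath holomorphic_on_imp_continuous_on
              holomorphic_on_subset[OF holo]) (use pts r in auto)
  hence "(f has_contour_integral (2 * pi * \<i> * ?S)) (circlepath 0 r)"
    using I by (metis g_def has_contour_integral_integral)
  moreover have "norm (h (of_real r)) \<le> B" using r by (intro B) simp
  hence "0 \<le> B" by (rule order.trans[OF norm_ge_zero])
  moreover have "norm (f w) \<le> B / m / r ^ Suc n" if "norm (w - 0) = r" for w
    using that B[of w] m(2)[of w] m(1) r \<open>0 \<le> B\<close>
    unfolding f_def norm_divide norm_power by (intro divide_mono frac_le) auto
  ultimately have "norm (2 * pi * \<i> * ?S) \<le> B / m / r ^ Suc n * (2 * pi * r)"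
    using r m(1) by (intro has_contour_integral_bound_circlepath) auto
  hence "2 * pi * norm ?S \<le> 2 * pi * (B / (m * r ^ n))"
    using r unfolding norm_mult by (simp add: mult_ac)
  thus ?thesis by (subst (asm) mult_le_cancel_left_pos) simp_all
qed

section \<open>The remainder after the four poles nearest to the origin\<close>

lemma Ln_negative_real:
  assumes "lam < 0"
  shows "Ln (complex_of_real lam) = Complex (ln \<bar>lam\<bar>) pi"
  using assms by (intro complex_eqI) (auto simp: Im_Ln_eq_pi)

lemma norm_pole_power2:
  assumes "lam < 0"
  shows "norm (2 * of_real pi * \<i> * of_int k - Ln (complex_of_real lam)) ^ 2
           = (ln \<bar>lam\<bar>)\<^sup>2 + pi\<^sup>2 * (2 * of_int k - 1)\<^sup>2"
  unfolding cmod_power2 Ln_negative_real[OF assms]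
  by (simp add: power2_eq_square algebra_simps)

definition scaled_apostol_bernoulli :: "real \<Rightarrow> nat \<Rightarrow> complex \<Rightarrow> complex" where
  "scaled_apostol_bernoulli lam n z =
     (-1) ^ (n - 1) * Ln (complex_of_real lam) ^ n / fact n * complex_of_real lam powr z
       * apostol_bernoulli n z (complex_of_real lam)"

text \<open>
  The contribution of the pole \<open>2 \<pi> i k - L\<close> after normalisation. For real \<open>z\<close> between
  \<open>0\<close> and \<open>1\<close> and \<open>n \<ge> 2\<close> these are the terms of the Fourier series of the scaled polynomial.
\<close>

definition pole_term :: "real \<Rightarrow> nat \<Rightarrow> int \<Rightarrow> complex \<Rightarrow> complex" where
  "pole_term lam n k z =
     (Ln (complex_of_real lam) / (Ln (complex_of_real lam) - 2 * of_real pi * \<i> * of_int k)) ^ n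
       * exp (2 * of_real pi * \<i> * of_int k * z)"

definition four_pole_remainder :: "real \<Rightarrow> nat \<Rightarrow> complex \<Rightarrow> complex" where
  "four_pole_remainder lam n z =
     scaled_apostol_bernoulli lam n z - (\<Sum>k\<in>{-1..2}. pole_term lam n k z)"

text \<open>
  The remainder in the shape coefficient plus residues. For \<open>n = 0\<close> the pole terms would have the
  opposite sign, since the truncated exponent \<open>n - 1\<close> is then \<open>0\<close>.
\<close>

lemma four_pole_remainder_eq:
  assumes "lam < 0" "n > 0"
  defines "L \<equiv> Ln (complex_of_real lam)"
  defines "p \<equiv> \<lambda>k::int. 2 * of_real pi * \<i> * of_int k - L"
  shows "four_pole_remainder lam n z = (-1) ^ (n - 1) * L ^ n *
           (exp (z * L) * fps_nth (apostol_bernoulli_gf z lam) n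
              + (\<Sum>k\<in>{-1..2}. exp (2 * of_real pi * \<i> * of_int k * z) / p k ^ n))"
proof -
  have "pole_term lam n k z =
          - ((-1) ^ (n - 1) * L ^ n * (exp (2 * of_real pi * \<i> * of_int k * z) / p k ^ n))" for k
  proof -
    have "(L / (L - 2 * of_real pi * \<i> * of_int k)) ^ n = (- (L / p k)) ^ n"
      unfolding p_def by (metis minus_diff_eq minus_divide_right)
    also have "\<dots> = (-1) ^ n * (L ^ n / p k ^ n)"
      by (simp add: power_minus[of "L / p k"] power_divide)
    also have "(-1) ^ n = - ((-1 :: complex) ^ (n - 1))"
      using \<open>n > 0\<close> by (cases n) auto
    finally show ?thesis by (simp add: pole_term_def L_def)
  qed
  moreover have "scaled_apostol_bernoulli lam n z =
      (-1) ^ (n - 1) * L ^ n * (exp (z * L) * fps_nth (apostol_bernoulli_gf z lam) n)"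
    using assms(1) by (simp add: scaled_apostol_bernoulli_def apostol_bernoulli_def powr_def L_def)
  ultimately show ?thesis
    by (simp add: four_pole_remainder_def sum_negf sum_distrib_left distrib_left)
qed

text \<open>
  The first bound takes the numerator \<open>h w = w\<close>. For the second, the factor \<open>\<lambda> ^ z = exp (z L)\<close> is
  moved into the generating function, so that the difference of the values at \<open>z\<close> and \<open>0\<close> belongs to
  the single numerator \<open>h w = w * (exp (z * (w + L)) - 1)\<close>, which is \<open>O (\<bar>z\<bar>)\<close> on the circle. The
  factor \<open>norm z\<close> matters: it makes the bound comparable with the increase of the
  weight \<open>exp (2 (\<pi> + \<bar>L\<bar>) \<bar>z\<bar>)\<close> near \<open>z = 0\<close>.
\<close>

lemma four_pole_remainder_bounds:
  assumes "lam < 0"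
  defines "L \<equiv> Ln (complex_of_real lam)"
  defines "r \<equiv> norm (L + 3 * of_real pi * \<i>)"
  shows "\<exists>C\<ge>0. \<forall>n>0. norm (four_pole_remainder lam n 0) \<le> C * (norm L / r) ^ n \<and>
           (\<forall>z. norm (four_pole_remainder lam n z - four_pole_remainder lam n 0)
                  \<le> C * norm z * exp (norm z * (r + norm L)) * (norm L / r) ^ n)"
proof -
  define p where "p = (\<lambda>k::int. 2 * of_real pi * \<i> * of_int k - L)"
  have L: "L = Complex (ln \<bar>lam\<bar>) pi" unfolding L_def by (rule Ln_negative_real[OF assms(1)])
  have expL: "exp L = of_real lam" using assms(1) by (simp add: L_def)
  have r2: "r\<^sup>2 = (ln \<bar>lam\<bar>)\<^sup>2 + pi\<^sup>2 * 16"
    unfolding r_def L cmod_power2 by (simp add: power2_eq_square algebra_simps)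
  have "r \<noteq> 0" using r2 by (auto simp: add_nonneg_eq_0_iff)
  hence r: "r > 0" by (simp add: r_def)
  have p2: "norm (p k) ^ 2 = (ln \<bar>lam\<bar>)\<^sup>2 + pi\<^sup>2 * of_int ((2 * k - 1)\<^sup>2)" for k
    using norm_pole_power2[OF assms(1), of k] by (simp add: p_def L_def)
  have "norm (p k) < r \<longleftrightarrow> k \<in> {-1..2}" for k
  proof -
    have "norm (p k) < r \<longleftrightarrow> norm (p k) ^ 2 < r ^ 2"
      using r abs_le_square_iff[of r "norm (p k)"] by (simp flip: not_le)
    also have "\<dots> \<longleftrightarrow> real_of_int ((2 * k - 1)\<^sup>2) < real_of_int (4\<^sup>2)"
      unfolding p2 r2 by simp
    also have "\<dots> \<longleftrightarrow> \<bar>2 * k - 1\<bar> < \<bar>4\<bar>"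
      unfolding of_int_less_iff by (simp only: abs_le_square_iff flip: not_le)
    also have "\<dots> \<longleftrightarrow> k \<in> {-1..2}" unfolding atLeastAtMost_iff by presburger
    finally show ?thesis .
  qed
  hence inside: "{k. norm (p k) < r} = {-1..2}" by blast
  \<comment> \<open>The squared moduli of the poles are \<open>(log \<bar>\<lambda>\<bar>)\<^sup>2 + (2 k - 1)\<^sup>2 \<pi>\<^sup>2\<close> with odd \<open>2 k - 1\<close>, while the
      radius corresponds to the even number \<open>4\<close>.\<close>
  have on_circle: "norm (p k) \<noteq> r" for k
  proof
    assume "norm (p k) = r"
    hence "real_of_int ((2 * k - 1)\<^sup>2) = real_of_int (4\<^sup>2)" using p2[of k] r2 by simp
    hence "\<bar>2 * k - 1\<bar> = \<bar>4\<bar>" unfolding of_int_eq_iff by (simp only: power2_eq_iff) auto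
    thus False by presburger
  qed
  have p0: "p k \<noteq> 0" for k
  proof
    assume "p k = 0"
    hence "(2 * k - 1)\<^sup>2 = 0" using p2[of k] by (simp add: add_nonneg_eq_0_iff)
    thus False by simp presburger
  qed
  obtain m where m: "m > 0" "\<And>w. norm w = r \<Longrightarrow> m \<le> norm (exp L * exp w - 1)"
  proof -
    have ne: "sphere (0::complex) r \<noteq> {}" using r by simp
    have cont: "continuous_on (sphere 0 r) (\<lambda>w. norm (exp L * exp w - 1))"
      by (intro continuous_intros)
    from continuous_attains_inf[OF compact_sphere ne cont] obtain x where x: "x \<in> sphere 0 r"
      "\<forall>w\<in>sphere 0 r. norm (exp L * exp x - 1) \<le> norm (exp L * exp w - 1)"
      by (elim bexE)
    have "exp L * exp x \<noteq> 1"
      using exp_times_exp_eq_1_iff[of L x] on_circle x(1) unfolding p_def by auto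
    thus thesis using x by (intro that[of "norm (exp L * exp x - 1)"]) auto
  qed
  have lam1: "complex_of_real lam \<noteq> 1" using assms(1) by auto
  note gf = has_fps_expansion_apostol_bernoulli_gf[OF lam1]
  have bound: "norm (fps_nth F n + (\<Sum>k\<in>{-1..2}. h (p k) / p k ^ Suc n)) \<le> B / (m * r ^ n)"
    if "h holomorphic_on UNIV" "(\<lambda>w. h w / (of_real lam * exp w - 1)) has_fps_expansion F"
       "\<And>w. norm w = r \<Longrightarrow> norm (h w) \<le> B" for h F B n
    using coefficient_plus_residues_bound[of L h F r B m n] that r m lam1 inside
    by (simp add: expL p_def del: power_Suc)
  have D_eq: "four_pole_remainder lam n z = (-1) ^ (n - 1) * L ^ n *
           (exp (z * L) * fps_nth (apostol_bernoulli_gf z lam) n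
              + (\<Sum>k\<in>{-1..2}. exp (2 * of_real pi * \<i> * of_int k * z) / p k ^ n))"
    if "n > 0" for n z
    using four_pole_remainder_eq[OF assms(1) that] by (simp add: L_def p_def)
  have scale: "norm ((-1) ^ (n - 1) * L ^ n * S) \<le> B / m * (norm L / r) ^ n"
    if "norm S \<le> B / (m * r ^ n)" for S B n
  proof -
    have "norm L ^ n * norm S \<le> norm L ^ n * (B / (m * r ^ n))"
      by (intro mult_left_mono that) auto
    thus ?thesis by (simp add: norm_mult norm_power power_divide mult_ac)
  qed
  define C where "C = r / m * (1 + (r + norm L))"
  have C: "r / m \<le> C" "r / m * (r + norm L) \<le> C" "C \<ge> 0"
    using r m by (auto simp: C_def algebra_simps)
  have s: "norm L / r \<ge> 0" using r by simp
  show ?thesis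
  proof (intro exI[of _ C] conjI allI impI C)
    fix n :: nat assume n: "n > 0"
    have "norm (fps_nth (apostol_bernoulli_gf 0 lam) n + (\<Sum>k\<in>{-1..2}. p k / p k ^ Suc n))
            \<le> r / (m * r ^ n)"
      by (rule bound) (use gf[of 0] in \<open>auto intro!: holomorphic_intros\<close>)
    hence "norm (four_pole_remainder lam n 0) \<le> r / m * (norm L / r) ^ n"
      unfolding D_eq[OF n]
      using p0 by (intro scale) simp
    also have "\<dots> \<le> C * (norm L / r) ^ n" by (intro mult_right_mono C) (use s in auto)
    finally show "norm (four_pole_remainder lam n 0) \<le> C * (norm L / r) ^ n" .
    fix z
    define h where "h = (\<lambda>w. w * (exp (z * (w + L)) - 1))"
    define F where "F = fps_const (exp (z * L)) * apostol_bernoulli_gf z lam - apostol_bernoulli_gf 0 lam"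
    have "(\<lambda>w::complex. exp (z * L) * (w * exp (z * w) / (lam * exp w - 1))
              - w * exp (0 * w) / (lam * exp w - 1)) has_fps_expansion F"
      unfolding F_def by (intro fps_expansion_intros gf)
    also have "(\<lambda>w::complex. exp (z * L) * (w * exp (z * w) / (lam * exp w - 1))
              - w * exp (0 * w) / (lam * exp w - 1)) = (\<lambda>w::complex. h w / (lam * exp w - 1))"
      by (simp add: h_def fun_eq_iff exp_add distrib_left right_diff_distrib diff_divide_distrib mult_ac)
    finally have F: "(\<lambda>w::complex. h w / (lam * exp w - 1)) has_fps_expansion F" .
    define B where "B = r * (norm z * (r + norm L) * exp (norm z * (r + norm L)))"
    have B: "norm (h w) \<le> B" if "norm w = r" for w
    proof -
      have le: "norm (z * (w + L)) \<le> norm z * (r + norm L)"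
        using norm_triangle_ineq[of w L] that by (auto simp: norm_mult intro!: mult_left_mono)
      have "norm (exp (z * (w + L)) - 1) \<le> norm (z * (w + L)) * exp (norm (z * (w + L)))"
        by (rule norm_exp_minus_one_le_linear)
      also have "\<dots> \<le> norm z * (r + norm L) * exp (norm z * (r + norm L))"
        using le r by (intro mult_mono) auto
      finally show ?thesis
        using r that by (simp add: h_def norm_mult B_def mult_left_mono)
    qed
    have "norm (fps_nth F n + (\<Sum>k\<in>{-1..2}. h (p k) / p k ^ Suc n)) \<le> B / (m * r ^ n)"
      by (rule bound[OF _ F B]) (auto intro!: holomorphic_intros simp: h_def)
    also have "fps_nth F n + (\<Sum>k\<in>{-1..2}. h (p k) / p k ^ Suc n) =
        (exp (z * L) * fps_nth (apostol_bernoulli_gf z lam) n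
              + (\<Sum>k\<in>{-1..2}. exp (2 * of_real pi * \<i> * of_int k * z) / p k ^ n))
        - (exp (0 * L) * fps_nth (apostol_bernoulli_gf 0 lam) n
              + (\<Sum>k\<in>{-1..2}. exp (2 * of_real pi * \<i> * of_int k * 0) / p k ^ n))"
    proof -
      have "h (p k) / p k ^ Suc n =
              exp (2 * of_real pi * \<i> * of_int k * z) / p k ^ n - exp 0 / p k ^ n" for k
      proof -
        have "h (p k) = p k * (exp (2 * of_real pi * \<i> * of_int k * z) - 1)"
          by (simp add: h_def p_def mult_ac)
        thus ?thesis using p0[of k] by (simp add: diff_divide_distrib)
      qed
      thus ?thesis by (simp add: F_def sum_subtractf)
    qed
    finally have "norm (four_pole_remainder lam n z - four_pole_remainder lam n 0)
                    \<le> B / m * (norm L / r) ^ n"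
      unfolding D_eq[OF n]
        right_diff_distrib[symmetric] by (rule scale)
    also have "B / m = (r / m * (r + norm L)) * (norm z * exp (norm z * (r + norm L)))"
      by (simp add: B_def)
    also have "\<dots> * (norm L / r) ^ n \<le> C * (norm z * exp (norm z * (r + norm L))) * (norm L / r) ^ n"
      by (intro mult_right_mono C) (use s in auto)
    finally show "norm (four_pole_remainder lam n z - four_pole_remainder lam n 0)
                  \<le> C * norm z * exp (norm z * (r + norm L)) * (norm L / r) ^ n"
      by (simp add: mult_ac)
  qed
qed

section \<open>The error term and its constant\<close>

lemma pole_term_bounds:
  fixes lam :: real and k :: int
  defines "L \<equiv> Ln (complex_of_real lam)"
  defines "Q \<equiv> norm L / norm (L - 2 * of_real pi * \<i> * of_int k)"
  shows "norm (pole_term lam n k z) \<le> Q ^ n * exp (2 * pi * \<bar>of_int k\<bar> * norm z)"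
    and "norm (pole_term lam n k z - pole_term lam n k 0)
           \<le> Q ^ n * (exp (2 * pi * \<bar>of_int k\<bar> * norm z) - 1)"
proof -
  define w where "w = 2 * of_real pi * \<i> * of_int k * z"
  have w: "norm w = 2 * pi * \<bar>of_int k\<bar> * norm z" by (simp add: w_def norm_mult)
  have Q: "norm ((L / (L - 2 * of_real pi * \<i> * of_int k)) ^ n) = Q ^ n" "Q ^ n \<ge> 0"
    by (simp_all add: Q_def norm_power norm_divide)
  have "norm (pole_term lam n k z) = Q ^ n * norm (exp w)"
    using Q by (simp add: pole_term_def w_def L_def norm_mult)
  also have "\<dots> \<le> Q ^ n * exp (norm w)"
    by (intro mult_left_mono norm_exp Q)
  finally show "norm (pole_term lam n k z) \<le> Q ^ n * exp (2 * pi * \<bar>of_int k\<bar> * norm z)"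
    by (simp add: w)
  have "pole_term lam n k z - pole_term lam n k 0
          = (L / (L - 2 * of_real pi * \<i> * of_int k)) ^ n * (exp w - 1)"
    by (simp add: pole_term_def w_def L_def right_diff_distrib)
  hence "norm (pole_term lam n k z - pole_term lam n k 0) = Q ^ n * norm (exp w - 1)"
    using Q by (simp add: norm_mult)
  also have "\<dots> \<le> Q ^ n * (exp (norm w) - 1)"
    by (intro mult_left_mono norm_exp_minus_one_le Q)
  finally show "norm (pole_term lam n k z - pole_term lam n k 0)
                  \<le> Q ^ n * (exp (2 * pi * \<bar>of_int k\<bar> * norm z) - 1)"
    by (simp add: w)
qed

text \<open>
  At the times when \<open>v ^ n\<close> is close to \<open>1\<close>, the left-hand side is close to \<open>2\<close>.
\<close>

lemma two_le_bound_of_unimodular_sum: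
  fixes v :: complex and b :: "nat \<Rightarrow> real"
  assumes "norm v = 1" "b \<longlonglongrightarrow> 0"
    and le: "\<And>n. n \<ge> N \<Longrightarrow> norm (1 + v ^ n) \<le> c + b n"
  shows "2 \<le> c"
proof (rule field_le_epsilon)
  fix e :: real assume "e > 0"
  with assms(2) have "\<forall>\<^sub>F n in sequentially. b n < e / 2"
    by (intro order_tendstoD) auto
  then obtain M where M: "\<And>n. n \<ge> M \<Longrightarrow> b n < e / 2"
    by (auto simp: eventually_sequentially)
  obtain n where n: "n \<ge> max M N" "norm (v ^ n - 1) < e / 2"
    using unimodular_power_recurs[OF assms(1), of "e / 2" "max M N"] \<open>e > 0\<close> by auto
  have "2 = norm ((1 + v ^ n) - (v ^ n - 1))" by simp
  also have "\<dots> \<le> norm (1 + v ^ n) + norm (v ^ n - 1)" by (rule norm_triangle_ineq4)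
  also have "\<dots> \<le> c + e" using le[of n] M[of n] n by simp
  finally show "2 \<le> c + e" .
qed

text \<open>
  With \<open>y = exp (2 * pi * x)\<close> one has \<open>\<delta> \<le> y - 1\<close> and \<open>2 * (y - 1) \<le> y\<^sup>2 - 1\<close>, so the three
  increments on the left add up to at most \<open>2 * (y\<^sup>2 - 1)\<close>; and \<open>c \<ge> 2\<close> times the increment of
  \<open>exp (M * x)\<close> from \<open>0\<close> to \<open>x\<close> is at least that.
\<close>

lemma sharp_constant_absorption:
  fixes c x M \<delta> :: real
  assumes "2 \<le> c" "0 \<le> x" "4 * pi \<le> M" "\<delta> \<le> 2 * pi * x"
  shows "c + (exp (2 * pi * x) - 1) + (exp (4 * pi * x) - 1) + \<delta> \<le> c * exp (M * x)"
proof -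
  have 1: "1 + 2 * pi * x \<le> exp (2 * pi * x)" by (rule exp_ge_add_one_self)
  have "exp (4 * pi * x) = exp (2 * pi * x) * exp (2 * pi * x)"
    by (simp flip: exp_add)
  moreover have "0 \<le> (exp (2 * pi * x) - 1) * (exp (2 * pi * x) - 1)" by simp
  ultimately have 2: "2 * (exp (2 * pi * x) - 1) \<le> exp (4 * pi * x) - 1"
    by (simp add: algebra_simps)
  have "2 * (exp (4 * pi * x) - 1) \<le> c * (exp (4 * pi * x) - 1)"
    using assms(1,2) by (intro mult_right_mono) auto
  also have "\<dots> \<le> c * (exp (M * x) - 1)"
    using assms by (intro mult_left_mono) (auto intro: mult_right_mono)
  finally show ?thesis using 1 2 assms(4) unfolding right_diff_distrib by linarith
qed

theorem proposition7:
  fixes lam :: real and K :: "complex set"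
  assumes "lam < 0" and "compact K"
  defines "L \<equiv> Ln (complex_of_real lam)"
  defines "u \<equiv> (complex_of_real (ln \<bar>lam\<bar>) + complex_of_real pi * \<i>)
             / (complex_of_real (ln \<bar>lam\<bar>) - complex_of_real pi * \<i>)"
  defines "A \<equiv> \<lambda>(n::nat) (z::complex).
     (-1) ^ (n - 1) * L ^ n / fact n * complex_of_real lam powr z
       * apostol_bernoulli n z (complex_of_real lam)"
  defines "R \<equiv> \<lambda>(n::nat) (z::complex).
     A n z - (1 + u ^ n * exp (2 * complex_of_real pi * \<i> * z))"
  defines "E \<equiv> \<lambda>(n::nat) (z::complex).
     exp (2 * (pi + norm L) * norm z) / norm (1 + 2 * complex_of_real pi * \<i> / L) ^ n"
  shows "(\<exists>C. \<forall>n\<ge>2. \<forall>z\<in>K. norm (R n z) \<le> C * E n z)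
    \<and> (\<forall>c. (\<forall>n\<ge>2. norm (R n 0) \<le> c * E n 0) \<longrightarrow>
           (\<exists>N. \<forall>n\<ge>N. \<forall>z\<in>K. norm (R n z) \<le> c * E n z))
    \<and> norm u = 1
    \<and> (Arg u / (2 * pi) \<in> \<rat> \<longrightarrow> (\<exists>p>0. \<forall>n. u ^ (n + p) = u ^ n))
    \<and> (Arg u / (2 * pi) \<notin> \<rat> \<longrightarrow> closure (range (\<lambda>n. u ^ n)) = sphere 0 1)
    \<and> uniform_limit K (\<lambda>n z. A n z - u ^ n * exp (2 * complex_of_real pi * \<i> * z)) (\<lambda>_. 1) sequentially"
proof -
  have L: "L = Complex (ln \<bar>lam\<bar>) pi" unfolding L_def by (rule Ln_negative_real[OF assms(1)])
  have L0: "L \<noteq> 0" using L by (auto simp: complex_eq_iff)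
  have pi_le: "pi \<le> norm L" using abs_Im_le_cmod[of L] by (simp add: L)
  define D where "D = four_pole_remainder lam"
  \<comment> \<open>\<open>W\<close> collects the two poles of the second smallest modulus, \<open>D\<close> everything beyond them.\<close>
  define W where "W = (\<lambda>n z. pole_term lam n (-1) z + pole_term lam n 2 z)"
  define r where "r = norm (L + 3 * of_real pi * \<i>)"
  define d where "d = norm (L + 2 * of_real pi * \<i>)"
  define q where "q = norm L / d"
  have sq: "(norm L)\<^sup>2 = (ln \<bar>lam\<bar>)\<^sup>2 + pi\<^sup>2" "d\<^sup>2 = (ln \<bar>lam\<bar>)\<^sup>2 + pi\<^sup>2 * 9"
    "r\<^sup>2 = (ln \<bar>lam\<bar>)\<^sup>2 + pi\<^sup>2 * 16"
    unfolding d_def r_def L cmod_power2 by (simp_all add: power2_eq_square algebra_simps)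
  have dL: "d > norm L"
    by (rule power2_less_imp_less, unfold sq) (simp_all add: d_def)
  have dr: "r > d"
    by (rule power2_less_imp_less, unfold sq) (simp_all add: r_def)
  have "norm (L - 4 * of_real pi * \<i>) = d"
    unfolding d_def cmod_def L by (simp add: power2_eq_square algebra_simps)
  moreover have "d > 0" using dL norm_ge_zero[of L] by linarith
  ultimately have d: "d > norm L" "d > 0" "norm (L - 4 * of_real pi * \<i>) = d" "r > d"
    using dL dr by auto
  have q: "0 < q" "q < 1" using d L0 by (auto simp: q_def)
  have E: "E n z = q ^ n * exp (2 * (pi + norm L) * norm z)" for n z
  proof -
    have "1 + 2 * complex_of_real pi * \<i> / L = (L + 2 * of_real pi * \<i>) / L"
      using L0 by (simp add: field_simps)
    thus ?thesis by (simp add: E_def q_def d_def norm_divide power_divide)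
  qed
  have u: "u = L / (L - 2 * of_real pi * \<i>)"
    unfolding u_def by (rule arg_cong2[of _ _ _ _ "(/)"]) (auto simp: L complex_eq_iff)
  have R: "R n z = W n z + D n z" for n z
  proof -
    have "{-1..2::int} = {-1, 0, 1, 2}" by auto
    moreover have "A n z = scaled_apostol_bernoulli lam n z"
      by (simp add: A_def scaled_apostol_bernoulli_def L_def)
    moreover have "pole_term lam n 0 z = 1"
      using L0 by (simp add: pole_term_def L_def)
    moreover have "pole_term lam n 1 z = u ^ n * exp (2 * complex_of_real pi * \<i> * z)"
      by (simp add: pole_term_def u L_def)
    ultimately show ?thesis by (simp add: R_def D_def four_pole_remainder_def W_def)
  qed
  have norm_u: "norm u = 1"
  proof -
    have "L - 2 * of_real pi * \<i> = cnj L" by (simp add: L complex_eq_iff)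
    thus ?thesis using L0 by (simp add: u norm_divide)
  qed

  have W_le: "norm (W n z) \<le> q ^ n * (exp (2 * pi * norm z) + exp (4 * pi * norm z))" for n z
    using pole_term_bounds(1)[of lam n "-1" z] pole_term_bounds(1)[of lam n 2 z] d(3)
    by (auto simp: W_def q_def d_def distrib_left mult_ac simp flip: L_def intro!: norm_triangle_le)
  have W_diff: "norm (W n z - W n 0)
      \<le> q ^ n * ((exp (2 * pi * norm z) - 1) + (exp (4 * pi * norm z) - 1))" for n z
    unfolding W_def add_diff_add
    using pole_term_bounds(2)[of lam n "-1" z] pole_term_bounds(2)[of lam n 2 z] d(3)
    by (intro norm_triangle_le) (auto simp: q_def d_def algebra_simps simp flip: L_def)

  obtain C where C: "C \<ge> 0" and D0: "\<And>n. n > 0 \<Longrightarrow> norm (D n 0) \<le> C * (norm L / r) ^ n"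
    and D_diff: "\<And>n z. n > 0 \<Longrightarrow>
      norm (D n z - D n 0) \<le> C * norm z * exp (norm z * (r + norm L)) * (norm L / r) ^ n"
    using four_pole_remainder_bounds[OF assms(1)] unfolding D_def r_def L_def by metis
  \<comment> \<open>The ratio by which \<open>D\<close> decays faster than the order \<open>q ^ n\<close> of the error term.\<close>
  define t where "t = d / r"
  have t: "0 < t" "t < 1" using d by (auto simp: t_def)
  have s: "(norm L / r) ^ n = q ^ n * t ^ n" for n
    using d by (simp add: q_def t_def flip: power_mult_distrib)
  obtain \<rho> where \<rho>: "\<rho> > 0" "\<And>z. z \<in> K \<Longrightarrow> norm z \<le> \<rho>"
    using compact_imp_bounded[OF assms(2)] unfolding bounded_pos by auto
  define C2 where "C2 = C * exp (\<rho> * (r + norm L))"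
  have C2: "C2 \<ge> 0" using C by (simp add: C2_def)
  have D_diff_K: "norm (D n z - D n 0) \<le> q ^ n * (C2 * t ^ n * norm z)" if "n > 0" "z \<in> K" for n z
  proof -
    have "exp (norm z * (r + norm L)) \<le> exp (\<rho> * (r + norm L))"
      using \<rho>(2)[OF that(2)] by (auto simp: r_def intro!: mult_right_mono)
    hence "C * norm z * exp (norm z * (r + norm L)) * (norm L / r) ^ n
            \<le> C * norm z * exp (\<rho> * (r + norm L)) * (norm L / r) ^ n"
      using C d by (intro mult_right_mono mult_left_mono) auto
    with D_diff[OF that(1), of z] show ?thesis by (simp add: s C2_def mult_ac)
  qed

  define C1 where "C1 = exp (2 * pi * \<rho>) + exp (4 * pi * \<rho>) + C + C2 * \<rho>"
  have R_le: "norm (R n z) \<le> C1 * q ^ n" if "n > 0" "z \<in> K" for n z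
  proof -
    have tn: "0 \<le> t ^ n" "t ^ n \<le> 1" using t by (auto intro: power_le_one)
    have "R n z = W n z + D n 0 + (D n z - D n 0)" by (simp add: R)
    hence "norm (R n z) \<le> norm (W n z) + norm (D n 0) + norm (D n z - D n 0)"
      by (metis norm_triangle_mono order_refl norm_triangle_ineq)
    also have "norm (W n z) \<le> q ^ n * (exp (2 * pi * \<rho>) + exp (4 * pi * \<rho>))"
      using q \<rho>(2)[OF that(2)]
      by (intro order.trans[OF W_le] mult_left_mono add_mono) auto
    also have "norm (D n 0) \<le> q ^ n * C"
    proof -
      have "C * t ^ n \<le> C * 1" using C tn by (intro mult_left_mono)
      hence "q ^ n * (C * t ^ n) \<le> q ^ n * C" using q by (intro mult_left_mono) auto
      with D0[OF that(1)] show ?thesis by (simp add: s mult_ac)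
    qed
    also have "norm (D n z - D n 0) \<le> q ^ n * (C2 * \<rho>)"
    proof -
      have "C2 * t ^ n * norm z \<le> C2 * 1 * \<rho>"
        using C2 tn \<rho>(2)[OF that(2)] by (intro mult_mono) auto
      hence "q ^ n * (C2 * t ^ n * norm z) \<le> q ^ n * (C2 * 1 * \<rho>)"
        using q by (intro mult_left_mono) auto
      with D_diff_K[OF that] show ?thesis by simp
    qed
    finally show ?thesis by (simp add: C1_def algebra_simps)
  qed
  have C1: "C1 \<ge> 0" using C C2 \<rho> by (simp add: C1_def)

  have "\<exists>C. \<forall>n\<ge>2. \<forall>z\<in>K. norm (R n z) \<le> C * E n z"
  proof (intro exI[of _ C1] allI impI ballI)
    fix n :: nat and z assume n: "n \<ge> 2" and z: "z \<in> K"
    have "q ^ n * 1 \<le> E n z" unfolding E using q by (intro mult_left_mono) auto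
    hence "C1 * q ^ n \<le> C1 * E n z" using C1 by (intro mult_left_mono) auto
    with R_le[of n z] n z show "norm (R n z) \<le> C1 * E n z" by simp
  qed
  moreover have "\<exists>N. \<forall>n\<ge>N. \<forall>z\<in>K. norm (R n z) \<le> c * E n z"
    if c: "\<forall>n\<ge>2. norm (R n 0) \<le> c * E n 0" for c
  proof -
    \<comment> \<open>\<open>v\<close> is the quotient of the bases of the two terms of \<open>W\<close>, which have equal modulus.\<close>
    define v where "v = (L + 2 * of_real pi * \<i>) / (L - 4 * of_real pi * \<i>)"
    have "norm v = 1" using d by (simp add: v_def norm_divide d_def[symmetric])
    have R0: "norm (R n 0) \<le> c * q ^ n" if "n \<ge> 2" for n using c that by (simp add: E)
    have t_lim: "(\<lambda>n. B * t ^ n) \<longlonglongrightarrow> 0" for B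
      using t by (intro tendsto_mult_right_zero LIMSEQ_realpow_zero) auto
    have "norm (1 + v ^ n) \<le> c + C * t ^ n" if n: "n \<ge> 2" for n
    proof -
      have nz: "L + 2 * of_real pi * \<i> \<noteq> 0" using d by (auto simp: d_def)
      have "W n 0 = (L / (L + 2 * of_real pi * \<i>)) ^ n * (1 + v ^ n)"
        using nz by (simp add: W_def pole_term_def v_def power_divide distrib_left mult.assoc flip: L_def)
      hence "q ^ n * norm (1 + v ^ n) = norm (W n 0)"
        by (simp add: norm_mult norm_power norm_divide q_def d_def)
      also have "\<dots> \<le> norm (R n 0) + norm (D n 0)"
        using norm_triangle_ineq4[of "R n 0" "D n 0"] by (simp add: R)
      also have "\<dots> \<le> q ^ n * (c + C * t ^ n)"
        using R0[OF n] D0[of n] n by (simp add: s algebra_simps)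
      finally show ?thesis using q by simp
    qed
    hence c2: "2 \<le> c" by (rule two_le_bound_of_unimodular_sum[OF \<open>norm v = 1\<close> t_lim])
    have "\<forall>\<^sub>F n in sequentially. C2 * t ^ n < 2 * pi"
      by (rule order_tendstoD[OF t_lim]) simp
    then obtain N where N: "\<And>n. n \<ge> N \<Longrightarrow> C2 * t ^ n < 2 * pi"
      by (auto simp: eventually_sequentially)
    show ?thesis
    proof (intro exI[of _ "max N 2"] allI impI ballI)
      fix n z assume n: "n \<ge> max N 2" and z: "z \<in> K"
      have "R n z = R n 0 + (W n z - W n 0) + (D n z - D n 0)" by (simp add: R)
      hence "norm (R n z) \<le> norm (R n 0) + norm (W n z - W n 0) + norm (D n z - D n 0)"
        by (metis norm_triangle_mono order_refl norm_triangle_ineq)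
      also have "\<dots> \<le> q ^ n * (c + (exp (2 * pi * norm z) - 1) + (exp (4 * pi * norm z) - 1)
                                + C2 * t ^ n * norm z)"
        using R0[of n] W_diff[of n z] D_diff_K[of n z] n z by (simp add: algebra_simps)
      also have "\<dots> \<le> q ^ n * (c * exp (2 * (pi + norm L) * norm z))"
      proof (intro mult_left_mono sharp_constant_absorption)
        show "C2 * t ^ n * norm z \<le> 2 * pi * norm z"
          using N[of n] n by (intro mult_right_mono) auto
      qed (use c2 pi_le q in auto)
      also have "\<dots> = c * E n z" by (simp add: E)
      finally show "norm (R n z) \<le> c * E n z" .
    qed
  qed
  moreover have "uniform_limit K (\<lambda>n z. A n z - u ^ n * exp (2 * complex_of_real pi * \<i> * z)) (\<lambda>_. 1) sequentially"
  proof (rule uniform_limitI)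
    fix e :: real assume "e > 0"
    have "(\<lambda>n. C1 * q ^ n) \<longlonglongrightarrow> 0"
      using q by (intro tendsto_mult_right_zero LIMSEQ_realpow_zero) auto
    hence "\<forall>\<^sub>F n in sequentially. C1 * q ^ n < e" using \<open>e > 0\<close> by (rule order_tendstoD)
    thus "\<forall>\<^sub>F n in sequentially. \<forall>z\<in>K.
            dist (A n z - u ^ n * exp (2 * complex_of_real pi * \<i> * z)) 1 < e"
      using eventually_gt_at_top[of 0]
    proof eventually_elim
      case (elim n)
      show ?case
      proof
        fix z assume "z \<in> K"
        have "dist (A n z - u ^ n * exp (2 * complex_of_real pi * \<i> * z)) 1 = norm (R n z)"
          by (simp add: R_def dist_norm algebra_simps)
        with R_le[OF elim(2) \<open>z \<in> K\<close>] elim(1)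
        show "dist (A n z - u ^ n * exp (2 * complex_of_real pi * \<i> * z)) 1 < e" by simp
      qed
    qed
  qed
  ultimately show ?thesis
    using norm_u unimodular_power_periodic[OF norm_u] unimodular_power_dense[OF norm_u] by blast
qed

end
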